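(* Let $n\ge2$ and let $\Gamma\subset\mathbb{R}^n$ be an open symmetric convex cone with vertex at the origin, $\partial\Gamma\ne\emptyset$, $\Gamma_n\subseteq\Gamma\subseteq\Gamma_1$. Then there is a positive constant $\vartheta_\Gamma$, depending only on $\Gamma$, such that the following holds for every smooth symmetric function $f:\Gamma\to\mathbb{R}$ that is concave in $\Gamma$ and satisfies: for each $\sigma<\sup_\Gamma f$ and each $\lambda\in\Gamma$, $\lim_{t\to+\infty}f(t\lambda)>\sigma$. For every $\lambda\in\Gamma$ one has $f_i(\lambda)\ge0$ for all $1\le i\le n$ and $\sum_{i=1}^n f_i(\lambda)>0$; and for each $\lambda\in\Gamma$ with $\lambda_1\le\cdots\le\lambda_n$, $$f_i(\lambda)\ge\vartheta_\Gamma\sum_{j=1}^n f_j(\lambda)\qquad\text{for all }1\le i\le\kappa_\Gamma+1 .$$ In particular, if $\kappa_\Gamma=n-1$ (i.e. $\Gamma$ is of type 2), then $f$ is of fully uniform ellipticity.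
   Context: $f_i=\partial f/\partial\lambda_i$. $\Gamma_n=\{\lambda\in\mathbb{R}^n:\lambda_i>0\ \forall i\}$, $\Gamma_1=\{\lambda\in\mathbb{R}^n:\sum_i\lambda_i>0\}$. $\kappa_\Gamma=\max\{l\in\{0,1,\dots\}:\ (-\alpha_1,\dots,-\alpha_l,\alpha_{l+1},\dots,\alpha_n)\in\Gamma\text{ for some }\alpha_1,\dots,\alpha_n>0\}$ (so $0\le\kappa_\Gamma\le n-1$). The cone $\Gamma$ is of type 1 if the positive coordinate axes lie in $\partial\Gamma$, and of type 2 otherwise. "$f$ is of $k$-uniform ellipticity" means: $f_i\ge0$ for all $i$ and $\sum_i f_i>0$ in $\Gamma$, and there is a constant $\theta>0$ such that for every $\lambda\in\Gamma$ with $\lambda_1\le\cdots\le\lambda_n$, $f_i(\lambda)\ge\theta\sum_{j=1}^nf_j(\lambda)$ for all $1\le i\le k$. "Fully uniform ellipticity" means $n$-uniform ellipticity.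
   Formalization: The sum of the f_i is shown positive only where f(λ) < sup f, and fully uniform ellipticity only if f < sup f on all of Γ; as stated the claim fails for constant f, and wherever f attains its supremum the gradient vanishes. *)

theory Defs
  imports "HOL-Analysis.Analysis"
begin

text \<open>
  Vectors of $R^n$ have type \<^typ>\<open>real ^ 'n\<close> for a finite, linearly ordered index type
  \<^typ>\<open>'n\<close>, so that $n$ is its cardinality. The order supplies the numbering $1,\dots,n$ of
  the coordinates.
\<close>

definition pos :: "'n::{finite,linorder} \<Rightarrow> nat" where
  "pos i = card {j. j \<le> i}"

definition ascending :: "real ^ 'n::{finite,linorder} \<Rightarrow> bool" where
  "ascending x \<longleftrightarrow> (\<forall>i j. i \<le> j \<longrightarrow> x $ i \<le> x $ j)"

definition permute_vec :: "('n \<Rightarrow> 'n) \<Rightarrow> real ^ 'n \<Rightarrow> real ^ 'n" where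
  "permute_vec p x = (\<chi> i. x $ p i)"

definition symmetric_set :: "(real ^ 'n) set \<Rightarrow> bool" where
  "symmetric_set S \<longleftrightarrow> (\<forall>p x. p permutes UNIV \<longrightarrow> x \<in> S \<longrightarrow> permute_vec p x \<in> S)"

definition symmetric_fun_on :: "(real ^ 'n) set \<Rightarrow> (real ^ 'n \<Rightarrow> real) \<Rightarrow> bool" where
  "symmetric_fun_on S f \<longleftrightarrow> (\<forall>p x. p permutes UNIV \<longrightarrow> x \<in> S \<longrightarrow> f (permute_vec p x) = f x)"

text \<open>
  The library predicates \<^const>\<open>cone\<close> and \<^const>\<open>conic\<close> also close the set under scaling
  by 0. The open cones meant here do not contain their vertex.
\<close>

definition cone_at_origin :: "(real ^ 'n) set \<Rightarrow> bool" where
  "cone_at_origin S \<longleftrightarrow> (\<forall>x\<in>S. \<forall>c>0. c *\<^sub>R x \<in> S)"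

definition Gamma_n :: "(real ^ 'n) set" where
  "Gamma_n = {x. \<forall>i. x $ i > 0}"

definition Gamma_1 :: "(real ^ 'n::finite) set" where
  "Gamma_1 = {x. (\<Sum>i\<in>UNIV. x $ i) > 0}"

definition admissible_cone :: "(real ^ 'n::finite) set \<Rightarrow> bool" where
  "admissible_cone \<Gamma> \<longleftrightarrow>
     open \<Gamma> \<and> symmetric_set \<Gamma> \<and> convex \<Gamma> \<and> cone_at_origin \<Gamma> \<and> frontier \<Gamma> \<noteq> {} \<and>
     Gamma_n \<subseteq> \<Gamma> \<and> \<Gamma> \<subseteq> Gamma_1"

definition kappa :: "(real ^ 'n::{finite,linorder}) set \<Rightarrow> nat" where
  "kappa \<Gamma> = Max {l. l \<le> CARD('n) \<and>
     (\<exists>\<alpha>::'n \<Rightarrow> real. (\<forall>i. \<alpha> i > 0) \<and> (\<chi> i. if pos i \<le> l then - \<alpha> i else \<alpha> i) \<in> \<Gamma>)}"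

definition type_1 :: "(real ^ 'n::finite) set \<Rightarrow> bool" where
  "type_1 \<Gamma> \<longleftrightarrow> (\<forall>i. \<forall>s>0. s *\<^sub>R axis i 1 \<in> frontier \<Gamma>)"

definition type_2 :: "(real ^ 'n::finite) set \<Rightarrow> bool" where
  "type_2 \<Gamma> \<longleftrightarrow> \<not> type_1 \<Gamma>"

definition partial :: "'n \<Rightarrow> (real ^ 'n::finite \<Rightarrow> real) \<Rightarrow> real ^ 'n \<Rightarrow> real" where
  "partial i f x = deriv (\<lambda>s. f (x + s *\<^sub>R axis i 1)) 0"

text \<open>
  On an open set \<^term>\<open>S\<close> the next predicate is membership in $C^k(S)$: partial derivatives
  that exist and are continuous force differentiability. Functions are total on
  \<^typ>\<open>real ^ 'n\<close>, but for open \<^term>\<open>S\<close> only their values on \<^term>\<open>S\<close> matter.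
\<close>

fun C_k_on :: "nat \<Rightarrow> (real ^ 'n::finite) set \<Rightarrow> (real ^ 'n \<Rightarrow> real) \<Rightarrow> bool" where
  "C_k_on 0 S f \<longleftrightarrow> continuous_on S f"
| "C_k_on (Suc k) S f \<longleftrightarrow>
     (\<forall>x\<in>S. f differentiable (at x)) \<and> (\<forall>i. C_k_on k S (partial i f))"

definition smooth_fun_on :: "(real ^ 'n::finite) set \<Rightarrow> (real ^ 'n \<Rightarrow> real) \<Rightarrow> bool" where
  "smooth_fun_on S f \<longleftrightarrow> (\<forall>k. C_k_on k S f)"

text \<open>The supremum and the limits along rays are extended reals, as both may be infinite.\<close>

definition sup_on :: "(real ^ 'n) set \<Rightarrow> (real ^ 'n \<Rightarrow> real) \<Rightarrow> ereal" where
  "sup_on S f = (SUP x\<in>S. ereal (f x))"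

definition ray_limit_condition :: "(real ^ 'n) set \<Rightarrow> (real ^ 'n \<Rightarrow> real) \<Rightarrow> bool" where
  "ray_limit_condition \<Gamma> f \<longleftrightarrow>
     (\<forall>\<sigma>::real. ereal \<sigma> < sup_on \<Gamma> f \<longrightarrow>
       (\<forall>x\<in>\<Gamma>. \<exists>L. ((\<lambda>t. ereal (f (t *\<^sub>R x))) \<longlongrightarrow> L) at_top \<and> ereal \<sigma> < L))"

text \<open>
  The ray limit condition does not keep \<^term>\<open>f\<close> from attaining its supremum (constants
  satisfy it). Where the supremum is attained the gradient vanishes, so strict positivity of the
  sum of the partial derivatives is possible only at points with value below the supremum.
\<close>

definition uniformly_elliptic ::
  "nat \<Rightarrow> (real ^ 'n::{finite,linorder}) set \<Rightarrow> (real ^ 'n::{finite,linorder} \<Rightarrow> real) \<Rightarrow> bool" where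
  "uniformly_elliptic k \<Gamma> f \<longleftrightarrow>
     (\<forall>x\<in>\<Gamma>. (\<forall>i. partial i f x \<ge> 0) \<and> (\<Sum>i\<in>UNIV. partial i f x) > 0) \<and>
     (\<exists>\<theta>>0. \<forall>x\<in>\<Gamma>. ascending x \<longrightarrow>
        (\<forall>i. pos i \<le> k \<longrightarrow> partial i f x \<ge> \<theta> * (\<Sum>j\<in>UNIV. partial j f x)))"

definition fully_uniformly_elliptic ::
  "(real ^ 'n::{finite,linorder}) set \<Rightarrow> (real ^ 'n::{finite,linorder} \<Rightarrow> real) \<Rightarrow> bool" where
  "fully_uniformly_elliptic \<Gamma> f \<longleftrightarrow> uniformly_elliptic CARD('n) \<Gamma> f"

end

theory Submission
  imports Defs
begin

text \<open>
  By concavity, $f(t\mu) \le f(\lambda) + Df(\lambda)(t\mu - \lambda)$ for $\lambda, \mu \in \Gamma$.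
  Letting $t \to \infty$, the ray limit condition forces $Df(\lambda)\mu \ge 0$, with strict
  inequality below the supremum of $f$. Concavity along a transposition of coordinates, together with
  symmetry, shows that the partial derivatives decrease when the coordinates increase. Testing
  $Df(\lambda)\mu \ge 0$ with the fixed vector
  $\mu = (-\alpha_1, \dots, -\alpha_\kappa, \alpha_{\kappa+1}, \dots, \alpha_n)$ then bounds
  $f_{\kappa+1}(\lambda)$ from below by a multiple of $f_1(\lambda)$.
\<close>

section \<open>Positions of the coordinates\<close>

lemma pos_le_card: "pos (i::'n::{finite,linorder}) \<le> CARD('n)"
  unfolding pos_def by (rule card_mono) auto

lemma pos_strict_mono: "i < j \<Longrightarrow> pos i < pos (j::'n::{finite,linorder})"
proof -
  assume "i < j"
  then have "{k. k \<le> i} \<subseteq> {k. k \<le> j}" "j \<in> {k. k \<le> j}" "j \<notin> {k. k \<le> i}" by auto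
  then have "{k. k \<le> i} \<subset> {k. k \<le> j}" by blast
  then show ?thesis unfolding pos_def by (intro psubset_card_mono) auto
qed

lemma pos_ge_1: "1 \<le> pos (i::'n::{finite,linorder})"
  unfolding pos_def using card_mono[of "{j. j \<le> i}" "{i}"] by auto

lemma pos_Min: "pos (Min (UNIV::'n::{finite,linorder} set)) = 1"
proof -
  have "{j. j \<le> Min (UNIV::'n set)} = {Min UNIV}"
    by (auto intro: antisym)
  then show ?thesis by (simp add: pos_def)
qed

lemma pos_Max: "pos (Max (UNIV::'n::{finite,linorder} set)) = CARD('n)"
  unfolding pos_def by simp

text \<open>Only the largest index has position n. In the sign pattern for
  \<open>CARD('n) - 1\<close>, all coordinates except the last are therefore negative.\<close>

lemma pos_le_card_minus_1_iff:
  "pos (i::'n::{finite,linorder}) \<le> CARD('n) - 1 \<longleftrightarrow> i \<noteq> Max UNIV"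
proof
  assume "pos i \<le> CARD('n) - 1"
  moreover have "0 < CARD('n)" by simp
  ultimately have "pos i \<noteq> CARD('n)" by linarith
  then show "i \<noteq> Max UNIV" using pos_Max by blast
next
  assume "i \<noteq> Max UNIV"
  then have "i < Max UNIV" by (simp add: order_less_le)
  from pos_strict_mono[OF this] show "pos i \<le> CARD('n) - 1" by (simp add: pos_Max)
qed

section \<open>Partial derivatives and tangents of concave functions\<close>

lemma vec_eq_sum_axis: "(v::real ^ 'n::finite) = (\<Sum>i\<in>UNIV. (v $ i) *\<^sub>R axis i 1)"
  using basis_expansion[of v] by (simp add: scalar_mult_eq_scaleR)

lemma partial_eq_derivative:
  assumes "(f has_derivative D) (at x)"
  shows "partial i f x = D (axis i 1)"
proof -
  have "((\<lambda>s. f (x + s *\<^sub>R axis i 1)) has_derivative (\<lambda>s. D (s *\<^sub>R axis i 1))) (at 0)"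
    by (rule has_derivative_compose[of "\<lambda>s. x + s *\<^sub>R axis i 1" _ 0 UNIV f D])
      (use assms in \<open>auto intro!: derivative_eq_intros\<close>)
  moreover have "(\<lambda>s. D (s *\<^sub>R axis i 1)) = (*) (D (axis i 1))"
    using has_derivative_linear[OF assms] by (auto simp: linear_cmul)
  ultimately have "((\<lambda>s. f (x + s *\<^sub>R axis i 1)) has_field_derivative D (axis i 1)) (at 0)"
    by (simp add: has_field_derivative_def)
  then show ?thesis unfolding partial_def by (rule DERIV_imp_deriv)
qed

lemma derivative_eq_sum_partial:
  assumes "(f has_derivative D) (at x)"
  shows "D v = (\<Sum>i\<in>UNIV. v $ i * partial i f x)"
proof -
  have lin: "linear D" using assms by (rule has_derivative_linear)
  have "D v = D (\<Sum>i\<in>UNIV. (v $ i) *\<^sub>R axis i 1)" using vec_eq_sum_axis[of v] by simp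
  also have "\<dots> = (\<Sum>i\<in>UNIV. v $ i * D (axis i 1))"
    by (simp add: linear_sum[OF lin] linear_cmul[OF lin])
  finally show ?thesis by (simp add: partial_eq_derivative[OF assms])
qed

text \<open>Concavity bounds the difference quotient of f along the segment from \<open>x\<close> to
  \<open>y\<close> below by \<open>f y - f x\<close>; its limit as t decreases to 0 is
  \<open>D (y - x)\<close>.\<close>

lemma concave_on_below_tangent:
  fixes f :: "'a::real_normed_vector \<Rightarrow> real"
  assumes "concave_on S f" "x \<in> S" "y \<in> S" "(f has_derivative D) (at x)"
  shows "f y \<le> f x + D (y - x)"
proof -
  let ?g = "\<lambda>t::real. f (x + t *\<^sub>R (y - x))"
  have "(?g has_derivative (\<lambda>t. D (t *\<^sub>R (y - x)))) (at 0)"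
    by (rule has_derivative_compose[of "\<lambda>t. x + t *\<^sub>R (y - x)" _ 0 UNIV f D])
      (use assms(4) in \<open>auto intro!: derivative_eq_intros\<close>)
  moreover have "(\<lambda>t. D (t *\<^sub>R (y - x))) = (*) (D (y - x))"
    using has_derivative_linear[OF assms(4)] by (auto simp: linear_cmul)
  ultimately have "(?g has_field_derivative D (y - x)) (at 0)"
    by (simp add: has_field_derivative_def)
  then have "((\<lambda>t. (?g t - f x) / t) \<longlongrightarrow> D (y - x)) (at 0)"
    by (simp add: has_field_derivative_iff)
  then have "((\<lambda>t. (?g t - f x) / t) \<longlongrightarrow> D (y - x)) (at_right 0)"
    by (rule filterlim_mono) (auto simp: at_le)
  moreover have "eventually (\<lambda>t. f y - f x \<le> (?g t - f x) / t) (at_right 0)"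
    unfolding eventually_at_right_field
  proof (intro exI[of _ 1] conjI allI impI)
    fix t :: real assume t: "0 < t" "t < 1"
    have eq: "(1 - t) *\<^sub>R x + t *\<^sub>R y = x + t *\<^sub>R (y - x)" by (simp add: algebra_simps)
    have "(1 - t) * f x + t * f y \<le> f ((1 - t) *\<^sub>R x + t *\<^sub>R y)"
      by (rule concave_onD[OF assms(1)]) (use t assms(2,3) in auto)
    then show "f y - f x \<le> (?g t - f x) / t"
      unfolding eq using t by (simp add: field_simps)
  qed simp
  ultimately have "f y - f x \<le> D (y - x)"
    by (intro tendsto_lowerbound[of _ _ "at_right 0"]) auto
  then show ?thesis by simp
qed

section \<open>Directions in the cone and limits along rays\<close>

text \<open>The sum is twice the midpoint.\<close>

lemma cone_add:
  assumes "convex S" "cone_at_origin S" "x \<in> S" "y \<in> S"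
  shows "x + y \<in> S"
proof -
  have "(1/2) *\<^sub>R x + (1/2) *\<^sub>R y \<in> S"
    by (rule convexD[OF assms(1,3,4)]) auto
  then have "2 *\<^sub>R ((1/2) *\<^sub>R x + (1/2) *\<^sub>R y) \<in> S"
    using assms(2) unfolding cone_at_origin_def by (meson zero_less_numeral)
  then show ?thesis by (simp add: algebra_simps)
qed

lemma smooth_imp_differentiable:
  assumes "smooth_fun_on S f" "x \<in> S"
  shows "f differentiable (at x)"
proof -
  have "C_k_on (Suc 0) S f" using assms(1) unfolding smooth_fun_on_def by blast
  then show ?thesis using assms(2) by simp
qed

lemma less_sup_on:
  assumes "x \<in> S" "\<sigma> < f x"
  shows "ereal \<sigma> < sup_on S f"
proof -
  have "ereal (f x) \<le> sup_on S f" unfolding sup_on_def using assms(1) by (rule SUP_upper)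
  then show ?thesis using assms(2) by (meson less_ereal.simps(1) less_le_trans)
qed

lemma ray_limit_eventually:
  assumes "ray_limit_condition S f" "ereal \<sigma> < sup_on S f" "x \<in> S"
  shows "eventually (\<lambda>t. \<sigma> < f (t *\<^sub>R x)) at_top"
proof -
  obtain L where "((\<lambda>t. ereal (f (t *\<^sub>R x))) \<longlongrightarrow> L) at_top" "ereal \<sigma> < L"
    using assms unfolding ray_limit_condition_def by blast
  from order_tendstoD(1)[OF this] show ?thesis by simp
qed

text \<open>If \<open>D y\<close> were negative, the tangent at \<open>x\<close> would force f to
  minus infinity along the ray through \<open>y\<close>, whereas the ray condition keeps f above a
  fixed level there.\<close>

lemma derivative_nonneg_on_cone:
  assumes cone: "cone_at_origin S" and conc: "concave_on S f" and ray: "ray_limit_condition S f"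
    and x: "x \<in> S" and y: "y \<in> S" and D: "(f has_derivative D) (at x)"
  shows "0 \<le> D y"
proof (rule ccontr)
  assume "\<not> 0 \<le> D y"
  then have neg: "D y < 0" by simp
  have lin: "linear D" using D by (rule has_derivative_linear)
  \<comment> \<open>The level \<open>f x - 1\<close> lies below the supremum even if f attains its
    supremum at \<open>x\<close>, so the ray condition applies at every point.\<close>
  have "eventually (\<lambda>t. f x - 1 < f (t *\<^sub>R y)) at_top"
    by (rule ray_limit_eventually[OF ray less_sup_on[OF x] y]) simp
  \<comment> \<open>Beyond this threshold the tangent bound \<open>f x + t * D y - D x\<close> is
    below \<open>f x - 1\<close>.\<close>
  moreover have "eventually (\<lambda>t. t > 0 \<and> t > (1 - D x) / (- D y)) at_top"
    by (intro eventually_conj eventually_gt_at_top)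
  ultimately have "eventually (\<lambda>t::real. False) at_top"
  proof eventually_elim
    case (elim t)
    have "t *\<^sub>R y \<in> S" using cone y elim unfolding cone_at_origin_def by blast
    from concave_on_below_tangent[OF conc x this D]
    have "f (t *\<^sub>R y) \<le> f x + t * D y - D x"
      by (simp add: linear_diff[OF lin] linear_cmul[OF lin])
    moreover have "1 - D x < t * (- D y)"
      using elim neg by (simp only: pos_divide_less_eq neg_0_less_iff_less)
    ultimately show ?case using elim by simp
  qed
  then show False by simp
qed

text \<open>If \<open>D y\<close> vanished, the tangent would bound f by \<open>f x - D x\<close>,
  hence by \<open>f x\<close>, on the whole ray through \<open>y\<close>. Below the supremum, the
  ray condition pushes f past \<open>f x\<close>.\<close>

lemma derivative_pos_on_cone:
  assumes cone: "cone_at_origin S" and conc: "concave_on S f" and ray: "ray_limit_condition S f"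
    and x: "x \<in> S" and y: "y \<in> S" and D: "(f has_derivative D) (at x)"
    and sup: "ereal (f x) < sup_on S f"
  shows "0 < D y"
proof (rule ccontr)
  assume "\<not> 0 < D y"
  then have zero: "D y = 0" using derivative_nonneg_on_cone[OF cone conc ray x y D] by simp
  have lin: "linear D" using D by (rule has_derivative_linear)
  \<comment> \<open>The point \<open>x\<close> is itself a direction in the cone.\<close>
  have "0 \<le> D x" by (rule derivative_nonneg_on_cone[OF cone conc ray x x D])
  have "eventually (\<lambda>t. f x < f (t *\<^sub>R y)) at_top"
    by (rule ray_limit_eventually[OF ray sup y])
  then have "eventually (\<lambda>t::real. False) at_top"
    using eventually_gt_at_top[of 0]
  proof eventually_elim
    case (elim t)
    have "t *\<^sub>R y \<in> S" using cone y elim unfolding cone_at_origin_def by blast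
    from concave_on_below_tangent[OF conc x this D]
    have "f (t *\<^sub>R y) \<le> f x - D x"
      by (simp add: linear_diff[OF lin] linear_cmul[OF lin] zero)
    then show ?case using elim \<open>0 \<le> D x\<close> by simp
  qed
  then show False by simp
qed

section \<open>Order of the partial derivatives\<close>

text \<open>Swapping coordinates i and j preserves the value of f. For distinct coordinates, the
  tangent inequality from \<open>x\<close> to the swapped point compares the two partial
  derivatives; for equal ones the swap fixes \<open>x\<close> and exchanges the two axis lines
  through it.\<close>

lemma partial_antimono:
  fixes f :: "real ^ 'n::finite \<Rightarrow> real"
  assumes "open S" and sset: "symmetric_set S" and sfun: "symmetric_fun_on S f"
    and conc: "concave_on S f" and x: "x \<in> S" and diff: "f differentiable (at x)"
    and le: "x $ i \<le> x $ j"
  shows "partial j f x \<le> partial i f x"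
proof (cases "i = j")
  case False
  then have "i \<noteq> j" .
  show ?thesis
  proof (cases "x $ i = x $ j")
    case True
    let ?p = "Transposition.transpose i j"
    have "isCont (\<lambda>s. x + s *\<^sub>R axis i 1) (0::real)"
      by (intro continuous_intros)
    then have "((\<lambda>s. x + s *\<^sub>R axis i 1) \<longlongrightarrow> x + 0 *\<^sub>R axis i 1) (nhds (0::real))"
      using tendsto_at_iff_tendsto_nhds[of "\<lambda>s. x + s *\<^sub>R axis i 1" "0::real"]
      by (simp add: isCont_def)
    \<comment> \<open>Symmetry of f is given only on \<open>S\<close>; openness keeps the axis line
      in \<open>S\<close> for small \<open>s\<close>, and the derivative at 0 sees nothing
      more.\<close>
    then have "eventually (\<lambda>s. x + s *\<^sub>R axis i 1 \<in> S) (nhds (0::real))"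
      using topological_tendstoD[of _ "x + 0 *\<^sub>R axis i 1" _ S] \<open>open S\<close> x by simp
    then have "eventually (\<lambda>s. f (x + s *\<^sub>R axis j 1) = f (x + s *\<^sub>R axis i 1)) (nhds (0::real))"
    proof eventually_elim
      case (elim s)
      have "permute_vec ?p (x + s *\<^sub>R axis i 1) = x + s *\<^sub>R axis j 1"
        unfolding vec_eq_iff
      proof
        fix k
        show "permute_vec ?p (x + s *\<^sub>R axis i 1) $ k = (x + s *\<^sub>R axis j 1) $ k"
          using \<open>i \<noteq> j\<close> True by (cases "k = i"; cases "k = j") (simp_all add: permute_vec_def axis_def)
      qed
      then show ?case
        using sfun elim permutes_swap_id[of i UNIV j] unfolding symmetric_fun_on_def
        by (metis UNIV_I)
    qed
    then have "partial j f x = partial i f x"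
      unfolding partial_def by (rule deriv_cong_ev) simp
    then show ?thesis by simp
  next
    case False
    then have lt: "x $ i < x $ j" using le by simp
    let ?p = "Transposition.transpose i j"
    have perm: "?p permutes UNIV" by (simp add: permutes_swap_id)
    have y: "permute_vec ?p x \<in> S" using sset x perm unfolding symmetric_set_def by blast
    have fy: "f (permute_vec ?p x) = f x" using sfun x perm unfolding symmetric_fun_on_def by blast
    obtain D where D: "(f has_derivative D) (at x)" using diff unfolding differentiable_def by blast
    have lin: "linear D" using D by (rule has_derivative_linear)
    have eq: "permute_vec ?p x - x = (x $ j - x $ i) *\<^sub>R (axis i 1 - axis j 1)"
      using \<open>i \<noteq> j\<close> by (auto simp: permute_vec_def vec_eq_iff axis_def Transposition.transpose_def)
    have "0 \<le> (x $ j - x $ i) * (D (axis i 1) - D (axis j 1))"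
      using concave_on_below_tangent[OF conc x y D] fy
      by (simp add: eq linear_cmul[OF lin] linear_diff[OF lin])
    then show ?thesis
      using lt by (simp add: partial_eq_derivative[OF D] zero_le_mult_iff)
  qed
qed simp

section \<open>The number kappa and the type of the cone\<close>

text \<open>A vector with only negative entries has a negative sum. This caps \<open>kappa\<close>
  at n - 1.\<close>

lemma kappa_set_not_card:
  fixes \<Gamma> :: "(real ^ 'n::{finite,linorder}) set"
  assumes "\<Gamma> \<subseteq> Gamma_1" "\<forall>i. \<alpha> i > 0"
  shows "(\<chi> i. if pos i \<le> CARD('n) then - \<alpha> i else \<alpha> i) \<notin> \<Gamma>"
proof
  assume "(\<chi> i. if pos i \<le> CARD('n) then - \<alpha> i else \<alpha> i) \<in> \<Gamma>"
  then have "0 < (\<Sum>i\<in>UNIV. - \<alpha> i)"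
    using assms(1) by (auto simp: Gamma_1_def pos_le_card)
  moreover have "(\<Sum>i\<in>UNIV. - \<alpha> i) \<le> 0"
    by (rule sum_nonpos) (use assms(2) in \<open>auto intro: less_imp_le\<close>)
  ultimately show False by simp
qed

text \<open>The maximum in \<open>kappa\<close> is attained, since it is taken over a finite set
  that contains 0. The resulting vector is the test direction for the ellipticity bound.\<close>

lemma kappa_witness:
  fixes \<Gamma> :: "(real ^ 'n::{finite,linorder}) set"
  assumes "Gamma_n \<subseteq> \<Gamma>"
  obtains \<alpha> where "\<And>i. 0 < \<alpha> i" "(\<chi> i. if pos i \<le> kappa \<Gamma> then - \<alpha> i else \<alpha> i) \<in> \<Gamma>"
proof -
  let ?K = "{l. l \<le> CARD('n) \<and>
     (\<exists>\<alpha>::'n \<Rightarrow> real. (\<forall>i. \<alpha> i > 0) \<and> (\<chi> i. if pos i \<le> l then - \<alpha> i else \<alpha> i) \<in> \<Gamma>)}"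
  \<comment> \<open>Positions start at 1, so for l = 0 no sign is flipped and the all-ones vector is
    a witness.\<close>
  have "\<not> pos i \<le> 0" for i :: 'n using pos_ge_1[of i] by simp
  then have "(\<chi> i. if pos (i::'n) \<le> 0 then - 1 else 1) \<in> Gamma_n"
    by (simp add: Gamma_n_def)
  then have "(\<chi> i. if pos (i::'n) \<le> 0 then - 1 else 1) \<in> \<Gamma>" using assms by blast
  then have "\<exists>\<alpha>. (\<forall>i::'n. 0 < \<alpha> i) \<and> (\<chi> i. if pos i \<le> 0 then - \<alpha> i else \<alpha> i) \<in> \<Gamma>"
    by (intro exI[of _ "\<lambda>_. 1"]) simp
  then have "?K \<noteq> {}" by blast
  moreover have "finite ?K" by (rule finite_subset[of _ "{..CARD('n)}"]) auto
  ultimately have "Max ?K \<in> ?K" by (intro Max_in)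
  then show ?thesis using that unfolding kappa_def by blast
qed

lemma kappa_eq_card_minus_1I:
  fixes \<Gamma> :: "(real ^ 'n::{finite,linorder}) set"
  assumes "\<Gamma> \<subseteq> Gamma_1" "\<And>i. 0 < \<alpha> i"
    "(\<chi> i. if pos i \<le> CARD('n) - 1 then - \<alpha> i else \<alpha> i) \<in> \<Gamma>"
  shows "kappa \<Gamma> = CARD('n) - 1"
  unfolding kappa_def
proof (rule Max_eqI, goal_cases)
  case (2 l)
  then have "l \<noteq> CARD('n)" using kappa_set_not_card[OF assms(1)] by blast
  moreover have "l \<le> CARD('n)" using 2 by blast
  ultimately show ?case by linarith
qed (use assms(2,3) in auto)

text \<open>Adding a small positive multiple of \<open>1\<close>, the all-ones vector, moves the
  axis point into the open orthant.\<close>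

lemma axis_in_closure_Gamma_n:
  assumes "0 < s"
  shows "s *\<^sub>R axis i 1 \<in> closure (Gamma_n :: (real ^ 'n::finite) set)"
proof (rule Lim_in_closed_set[of _ "\<lambda>e. s *\<^sub>R axis i 1 + e *\<^sub>R 1" "at_right (0::real)"])
  show "eventually (\<lambda>e. s *\<^sub>R axis i 1 + e *\<^sub>R 1 \<in> closure Gamma_n) (at_right (0::real))"
    using eventually_at_right_less
  proof eventually_elim
    case (elim e)
    then have "s *\<^sub>R axis i 1 + e *\<^sub>R 1 \<in> (Gamma_n :: (real ^ 'n) set)"
      using assms by (auto simp: Gamma_n_def axis_def)
    then show ?case using closure_subset by blast
  qed
  have "((\<lambda>e. s *\<^sub>R axis i 1 + e *\<^sub>R 1) \<longlongrightarrow> s *\<^sub>R axis i 1 + 0 *\<^sub>R (1 :: real ^ 'n)) (at_right (0::real))"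
    by (intro tendsto_intros)
  then show "((\<lambda>e. s *\<^sub>R axis i 1 + e *\<^sub>R 1) \<longlongrightarrow> s *\<^sub>R axis i (1::real)) (at_right (0::real))"
    by simp
qed auto

text \<open>Both conditions amount to \<Gamma> containing a point of the last positive axis:
  convexity leads from n - 1 negative entries to such a point, and openness leads back.\<close>

lemma kappa_eq_iff_type_2:
  fixes \<Gamma> :: "(real ^ 'n::{finite,linorder}) set"
  assumes adm: "admissible_cone \<Gamma>"
  shows "kappa \<Gamma> = CARD('n) - 1 \<longleftrightarrow> type_2 \<Gamma>"
proof
  have "open \<Gamma>" and conv: "convex \<Gamma>" and cone: "cone_at_origin \<Gamma>" and sub: "Gamma_n \<subseteq> \<Gamma>"
    using adm by (auto simp: admissible_cone_def)
  let ?m = "Max (UNIV::'n set)"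
  assume k: "kappa \<Gamma> = CARD('n) - 1"
  obtain \<alpha> where \<alpha>: "\<And>i. 0 < \<alpha> i" "(\<chi> i. if pos i \<le> kappa \<Gamma> then - \<alpha> i else \<alpha> i) \<in> \<Gamma>"
    using kappa_witness[OF sub] by blast
  have "(\<chi> i. \<alpha> i) \<in> \<Gamma>" using sub \<alpha>(1) by (auto simp: Gamma_n_def)
  \<comment> \<open>The positive vector \<alpha> cancels the n - 1 negative entries and doubles the
    last one.\<close>
  from cone_add[OF conv cone \<alpha>(2) this]
  have "(\<chi> i. if pos i \<le> kappa \<Gamma> then - \<alpha> i else \<alpha> i) + (\<chi> i. \<alpha> i) \<in> \<Gamma>" .
  also have "(\<chi> i. if pos i \<le> kappa \<Gamma> then - \<alpha> i else \<alpha> i) + (\<chi> i. \<alpha> i)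
      = (2 * \<alpha> ?m) *\<^sub>R axis ?m 1"
    unfolding k pos_le_card_minus_1_iff by (auto simp: vec_eq_iff axis_def)
  finally have "(2 * \<alpha> ?m) *\<^sub>R axis ?m 1 \<notin> frontier \<Gamma>"
    using \<open>open \<Gamma>\<close> by (simp add: frontier_def interior_open)
  moreover have "0 < 2 * \<alpha> ?m" using \<alpha>(1) by simp
  ultimately show "type_2 \<Gamma>" unfolding type_2_def type_1_def by blast
next
  have "open \<Gamma>" and sset: "symmetric_set \<Gamma>" and sub: "Gamma_n \<subseteq> \<Gamma>" "\<Gamma> \<subseteq> Gamma_1"
    using adm by (auto simp: admissible_cone_def)
  let ?m = "Max (UNIV::'n set)"
  assume "type_2 \<Gamma>"
  then obtain i s where s: "0 < s" "s *\<^sub>R axis i 1 \<notin> frontier \<Gamma>"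
    unfolding type_2_def type_1_def by blast
  \<comment> \<open>Axis points always lie in the closure of \<Gamma>, so one that misses the
    frontier is in \<Gamma>; symmetry then moves it to the last axis.\<close>
  moreover have "s *\<^sub>R axis i 1 \<in> closure \<Gamma>"
    using axis_in_closure_Gamma_n[OF s(1)] closure_mono[OF sub(1)] by blast
  ultimately have "s *\<^sub>R axis i 1 \<in> \<Gamma>"
    using \<open>open \<Gamma>\<close> by (simp add: frontier_def interior_open)
  then have "permute_vec (Transposition.transpose i ?m) (s *\<^sub>R axis i 1) \<in> \<Gamma>"
    using sset permutes_swap_id[of i UNIV ?m] unfolding symmetric_set_def by blast
  also have "permute_vec (Transposition.transpose i ?m) (s *\<^sub>R axis i 1) = s *\<^sub>R axis ?m 1"
    by (auto simp: permute_vec_def vec_eq_iff axis_def Transposition.transpose_def)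
  finally have last: "s *\<^sub>R axis ?m 1 \<in> \<Gamma>" .
  \<comment> \<open>The perturbation \<open>axis ?m 2 - 1\<close> has entry 1 at \<open>?m\<close>
    and -1 elsewhere, so \<open>?v e\<close> has last entry \<open>s + e\<close> and all others
    \<open>- e\<close>.\<close>
  let ?v = "\<lambda>e::real. s *\<^sub>R axis ?m 1 + e *\<^sub>R (axis ?m (2::real) - 1)"
  have "(?v \<longlongrightarrow> s *\<^sub>R axis ?m 1 + 0 *\<^sub>R (axis ?m (2::real) - 1)) (at_right 0)"
    by (intro tendsto_intros)
  then have "eventually (\<lambda>e. ?v e \<in> \<Gamma>) (at_right 0)"
    using topological_tendstoD[of ?v _ "at_right 0" \<Gamma>] \<open>open \<Gamma>\<close> last by simp
  then have "eventually (\<lambda>e::real. 0 < e \<and> ?v e \<in> \<Gamma>) (at_right 0)"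
    using eventually_at_right_less[of 0] by eventually_elim simp
  then obtain e where e: "0 < e" "?v e \<in> \<Gamma>"
    using eventually_happens[of _ "at_right (0::real)"] by auto
  let ?\<alpha> = "\<lambda>i. if i = ?m then s + e else e"
  have "?v e = (\<chi> i. if pos i \<le> CARD('n) - 1 then - ?\<alpha> i else ?\<alpha> i)"
    unfolding pos_le_card_minus_1_iff by (auto simp: vec_eq_iff axis_def)
  then show "kappa \<Gamma> = CARD('n) - 1"
    using e s by (intro kappa_eq_card_minus_1I[OF sub(2), of ?\<alpha>]) auto
qed

section \<open>The ellipticity bound\<close>

text \<open>The first weight is the largest, so the total is at most n times it. The test inequality
  moves the negative terms, among them the first, to the other side, where every remaining weight is
  at most \<open>d i\<close>.\<close>

lemma antimono_weights_lower_bound: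
  fixes d :: "'n::{finite,linorder} \<Rightarrow> real"
  assumes \<alpha>: "\<And>i. 0 < \<alpha> i" and d: "\<And>i. 0 \<le> d i" "\<And>i j. i \<le> j \<Longrightarrow> d j \<le> d i"
    and test: "0 \<le> (\<Sum>i\<in>UNIV. (if pos i \<le> k then - \<alpha> i else \<alpha> i) * d i)"
    and i: "pos i \<le> k + 1"
  shows "(Min (range \<alpha>) / (real CARD('n) * sum \<alpha> UNIV)) * sum d UNIV \<le> d i"
proof -
  let ?f = "Min (UNIV::'n set)" and ?m = "Min (range \<alpha>)" and ?A = "sum \<alpha> UNIV"
  have A: "0 < ?A" by (rule sum_pos) (use \<alpha> in auto)
  have "?m \<in> range \<alpha>" by (rule Min_in) auto
  then have m: "0 < ?m" using \<alpha> by auto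
  have "sum d UNIV \<le> (\<Sum>i\<in>(UNIV::'n set). d ?f)" by (rule sum_mono) (simp add: d(2))
  then have sum_d: "sum d UNIV \<le> real CARD('n) * d ?f" by simp
  have "?m * d ?f \<le> ?A * d i"
  \<comment> \<open>For \<open>k = 0\<close> the test sum has no negative term and gives no bound on
    the first weight, but then \<open>i\<close> is the first index itself.\<close>
  proof (cases "k = 0")
    case True
    have "i = ?f"
    proof (rule ccontr)
      assume "i \<noteq> ?f"
      then have "?f < i" by (simp add: order_less_le)
      then show False using pos_strict_mono[of ?f i] i True by (simp add: pos_Min)
    qed
    have "?m \<le> \<alpha> i" by simp
    also have "\<alpha> i \<le> ?A" by (rule member_le_sum) (use \<alpha> in \<open>auto intro: less_imp_le\<close>)
    finally show ?thesis using \<open>i = ?f\<close> d(1) by (simp add: mult_right_mono)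
  next
    case False
    let ?P = "{j. pos j \<le> k}" and ?Q = "{j::'n. \<not> pos j \<le> k}"
    have "(\<Sum>j\<in>UNIV. (if pos j \<le> k then - \<alpha> j else \<alpha> j) * d j)
        = (\<Sum>j\<in>UNIV. if pos j \<le> k then - (\<alpha> j * d j) else \<alpha> j * d j)"
      by (rule sum.cong) auto
    also have "\<dots> = (\<Sum>j\<in>?Q. \<alpha> j * d j) - (\<Sum>j\<in>?P. \<alpha> j * d j)"
      by (simp add: sum.If_cases sum_negf Collect_neg_eq)
    finally have "(\<Sum>j\<in>?P. \<alpha> j * d j) \<le> (\<Sum>j\<in>?Q. \<alpha> j * d j)" using test by simp
    moreover have "?f \<in> ?P" using False by (simp add: pos_Min)
    then have "\<alpha> ?f * d ?f \<le> (\<Sum>j\<in>?P. \<alpha> j * d j)"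
      using member_le_sum[of ?f ?P "\<lambda>j. \<alpha> j * d j"] \<alpha> d(1) by (simp add: less_imp_le)
    moreover have "?m * d ?f \<le> \<alpha> ?f * d ?f" by (intro mult_right_mono d) simp
    moreover have "(\<Sum>j\<in>?Q. \<alpha> j * d j) \<le> (\<Sum>j\<in>?Q. \<alpha> j * d i)"
    proof (rule sum_mono)
      fix j assume "j \<in> ?Q"
      \<comment> \<open>Here the bound \<open>k + 1\<close> enters: \<open>j\<close> has position at
        least \<open>k + 1\<close>, and \<open>i\<close> at most that.\<close>
      then have "i \<le> j" using i pos_strict_mono[of j i] by (fastforce simp: not_le)
      then show "\<alpha> j * d j \<le> \<alpha> j * d i" using \<alpha> d(2) by (simp add: less_imp_le)
    qed
    moreover have "(\<Sum>j\<in>?Q. \<alpha> j * d i) \<le> (\<Sum>j\<in>UNIV. \<alpha> j * d i)"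
      by (rule sum_mono2) (use \<alpha> d(1) in \<open>auto simp: less_imp_le\<close>)
    ultimately show ?thesis by (simp add: sum_distrib_right)
  qed
  then have "real CARD('n) * (?m * d ?f) \<le> real CARD('n) * (?A * d i)"
    by (rule mult_left_mono) simp
  moreover have "?m * sum d UNIV \<le> ?m * (real CARD('n) * d ?f)"
    by (rule mult_left_mono[OF sum_d less_imp_le[OF m]])
  ultimately have "?m * sum d UNIV \<le> d i * (real CARD('n) * ?A)"
    by (simp only: ac_simps)
  then show ?thesis using A by (simp add: pos_divide_le_eq)
qed

theorem theorem1p8:
  fixes \<Gamma> :: "(real ^ 'n::{finite,linorder}) set"
  assumes "CARD('n) \<ge> 2"
    and "admissible_cone \<Gamma>"
  shows "(kappa \<Gamma> = CARD('n) - 1 \<longleftrightarrow> type_2 \<Gamma>) \<and>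
    (\<exists>\<theta>>0. \<forall>f. smooth_fun_on \<Gamma> f \<longrightarrow> symmetric_fun_on \<Gamma> f \<longrightarrow> concave_on \<Gamma> f \<longrightarrow>
        ray_limit_condition \<Gamma> f \<longrightarrow>
      (\<forall>x\<in>\<Gamma>. (\<forall>i. partial i f x \<ge> 0) \<and>
          (ereal (f x) < sup_on \<Gamma> f \<longrightarrow> (\<Sum>i\<in>UNIV. partial i f x) > 0)) \<and>
      (\<forall>x\<in>\<Gamma>. ascending x \<longrightarrow>
          (\<forall>i. pos i \<le> kappa \<Gamma> + 1 \<longrightarrow>
            partial i f x \<ge> \<theta> * (\<Sum>j\<in>UNIV. partial j f x))) \<and>
      (kappa \<Gamma> = CARD('n) - 1 \<longrightarrow> (\<forall>x\<in>\<Gamma>. ereal (f x) < sup_on \<Gamma> f) \<longrightarrow>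
          fully_uniformly_elliptic \<Gamma> f))"
proof (intro conjI kappa_eq_iff_type_2[OF assms(2)])
  have "open \<Gamma>" and sset: "symmetric_set \<Gamma>" and cone: "cone_at_origin \<Gamma>" and sub: "Gamma_n \<subseteq> \<Gamma>"
    using assms(2) by (auto simp: admissible_cone_def)
  obtain \<alpha> where \<alpha>: "\<And>i. 0 < \<alpha> i" "(\<chi> i. if pos i \<le> kappa \<Gamma> then - \<alpha> i else \<alpha> i) \<in> \<Gamma>"
    using kappa_witness[OF sub] by blast
  \<comment> \<open>The vector \<alpha> is chosen from \<Gamma> before any f is considered, so this
    constant depends on \<Gamma> alone.\<close>
  define \<theta> where "\<theta> = Min (range \<alpha>) / (real CARD('n) * sum \<alpha> UNIV)"
  have "Min (range \<alpha>) \<in> range \<alpha>" by (rule Min_in) auto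
  then have "0 < Min (range \<alpha>)" using \<alpha>(1) by auto
  moreover have "0 < sum \<alpha> UNIV" by (rule sum_pos) (use \<alpha>(1) in auto)
  ultimately have \<theta>: "0 < \<theta>" by (simp add: \<theta>_def)
  have nonneg: "0 \<le> partial i f x"
    and pos: "ereal (f x) < sup_on \<Gamma> f \<Longrightarrow> 0 < (\<Sum>i\<in>UNIV. partial i f x)"
    and test: "0 \<le> (\<Sum>i\<in>UNIV. (if pos i \<le> kappa \<Gamma> then - \<alpha> i else \<alpha> i) * partial i f x)"
    if f: "smooth_fun_on \<Gamma> f" "concave_on \<Gamma> f" "ray_limit_condition \<Gamma> f" and x: "x \<in> \<Gamma>"
    for f x i
  proof -
    obtain D where D: "(f has_derivative D) (at x)"
      using smooth_imp_differentiable[OF f(1) x] unfolding differentiable_def by blast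
    have Dge: "0 \<le> D y" if "y \<in> \<Gamma>" for y
      by (rule derivative_nonneg_on_cone[OF cone f(2,3) x that D])
    \<comment> \<open>The axis vectors may lie on the frontier of \<Gamma>; the weak inequality
      reaches them by continuity of the linear map \<open>D\<close>.\<close>
    have "axis i 1 \<in> closure \<Gamma>"
      using axis_in_closure_Gamma_n[of 1 i] closure_mono[OF sub] by auto
    moreover have "continuous_on (closure \<Gamma>) D"
      using has_derivative_bounded_linear[OF D] by (rule linear_continuous_on)
    ultimately have "0 \<le> D (axis i 1)"
      using continuous_ge_on_closure[of \<Gamma> D "axis i 1" 0] Dge by blast
    then show "0 \<le> partial i f x" by (simp add: partial_eq_derivative[OF D])
    show "0 \<le> (\<Sum>i\<in>UNIV. (if pos i \<le> kappa \<Gamma> then - \<alpha> i else \<alpha> i) * partial i f x)"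
      using Dge[OF \<alpha>(2)] by (simp add: derivative_eq_sum_partial[OF D])
    assume sup: "ereal (f x) < sup_on \<Gamma> f"
    \<comment> \<open>At the all-ones vector, \<open>D\<close> is the sum of the partial
      derivatives.\<close>
    have "1 \<in> \<Gamma>" using sub by (auto simp: Gamma_n_def)
    from derivative_pos_on_cone[OF cone f(2,3) x this D sup]
    show "0 < (\<Sum>i\<in>UNIV. partial i f x)" by (simp add: derivative_eq_sum_partial[OF D])
  qed
  have bound: "\<theta> * (\<Sum>j\<in>UNIV. partial j f x) \<le> partial i f x"
    if f: "smooth_fun_on \<Gamma> f" "symmetric_fun_on \<Gamma> f" "concave_on \<Gamma> f" "ray_limit_condition \<Gamma> f"
      and x: "x \<in> \<Gamma>" "ascending x" and i: "pos i \<le> kappa \<Gamma> + 1" for f x i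
    unfolding \<theta>_def
  proof (rule antimono_weights_lower_bound[OF \<alpha>(1) _ _ test[OF f(1,3,4) x(1)] i])
    show "0 \<le> partial j f x" for j by (rule nonneg[OF f(1,3,4) x(1)])
    show "partial l f x \<le> partial j f x" if "j \<le> l" for j l
      using that x(2) unfolding ascending_def
      by (intro partial_antimono[OF \<open>open \<Gamma>\<close> sset f(2,3) x(1) smooth_imp_differentiable[OF f(1) x(1)]])
        blast
  qed
  show "\<exists>\<theta>>0. \<forall>f. smooth_fun_on \<Gamma> f \<longrightarrow> symmetric_fun_on \<Gamma> f \<longrightarrow> concave_on \<Gamma> f \<longrightarrow>
        ray_limit_condition \<Gamma> f \<longrightarrow>
      (\<forall>x\<in>\<Gamma>. (\<forall>i. partial i f x \<ge> 0) \<and>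
          (ereal (f x) < sup_on \<Gamma> f \<longrightarrow> (\<Sum>i\<in>UNIV. partial i f x) > 0)) \<and>
      (\<forall>x\<in>\<Gamma>. ascending x \<longrightarrow>
          (\<forall>i. pos i \<le> kappa \<Gamma> + 1 \<longrightarrow>
            partial i f x \<ge> \<theta> * (\<Sum>j\<in>UNIV. partial j f x))) \<and>
      (kappa \<Gamma> = CARD('n) - 1 \<longrightarrow> (\<forall>x\<in>\<Gamma>. ereal (f x) < sup_on \<Gamma> f) \<longrightarrow>
          fully_uniformly_elliptic \<Gamma> f)"
  proof (intro exI[of _ \<theta>] conjI \<theta> allI impI ballI)
    fix f
    assume f: "smooth_fun_on \<Gamma> f" "symmetric_fun_on \<Gamma> f" "concave_on \<Gamma> f"
      "ray_limit_condition \<Gamma> f"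
    assume k: "kappa \<Gamma> = CARD('n) - 1" and sup: "\<forall>x\<in>\<Gamma>. ereal (f x) < sup_on \<Gamma> f"
    \<comment> \<open>With \<open>kappa\<close> equal to n - 1, the range of the bound covers all n
      coordinates.\<close>
    have "pos i \<le> kappa \<Gamma> + 1" for i :: 'n using k pos_le_card[of i] by linarith
    then show "fully_uniformly_elliptic \<Gamma> f"
      unfolding fully_uniformly_elliptic_def uniformly_elliptic_def
      using nonneg[OF f(1,3,4)] pos[OF f(1,3,4)] bound[OF f] sup \<theta> by blast
  qed (auto intro: nonneg pos bound)
qed

end
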